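(* Let $u\in C_{+,\log}$ be (log, exp)-convex. Then its Legendre transform $\ell_u(t)$ is decreasing for large $t$ (i.e. there is $t_0\ge0$ such that $\ell_u(t)\ge \ell_u(s)$ whenever $s\ge t\ge t_0$), and $\lim_{t\to\infty}\ell_u(t)^{1/t}=0$.
   Context: $C_{+,\log}$ denotes the set of all positive continuous functions $u:[0,\infty)\to(0,\infty)$ with $\lim_{r\to\infty}\frac{\log u(r)}{\log r}=\infty$. For $u\in C_{+,\log}$ the Legendre transform is $\ell_u(t)=\inf_{r>0}\frac{u(r)}{r^t}$, $t\in[0,\infty)$. A positive continuous function $u$ on $[0,\infty)$ is (log, exp)-convex if $x\mapsto\log u(e^x)$ is convex on $\mathbb R$. "Decreasing" is meant in the non-strict sense. *)

theory Defs
  imports "HOL-Analysis.Analysis"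
begin

(* Functions on [0,\<infinity>) are represented by total functions real \<Rightarrow> real;
   the values at negative arguments are unconstrained and never used. *)

definition C_plus_log :: "(real \<Rightarrow> real) set" where
  "C_plus_log = {u. continuous_on {0..} u \<and> (\<forall>r\<ge>0. u r > 0) \<and>
                    filterlim (\<lambda>r. ln (u r) / ln r) at_top at_top}"

(* For u positive on [0,\<infinity>) and t \<ge> 0 the set of values below is nonempty and
   bounded below by 0, so the real-valued INF is the genuine infimum. *)
definition legendre :: "(real \<Rightarrow> real) \<Rightarrow> real \<Rightarrow> real" where
  "legendre u t = (INF r\<in>{0<..}. u r / r powr t)"

(* Meant for positive continuous u on [0,\<infinity>). *)
definition log_exp_convex :: "(real \<Rightarrow> real) \<Rightarrow> bool" where
  "log_exp_convex u \<longleftrightarrow> convex_on UNIV (\<lambda>x::real. ln (u (exp x)))"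

end

theory Submission
  imports Defs
begin

text \<open>
  Every single radius \<open>R\<close> gives the upper bound \<open>u R / R powr t\<close> for the Legendre transform at
  \<open>t\<close> (\<open>legendre_le\<close>), and both claims come from choosing \<open>R\<close> well.

  For the limit, the \<open>t\<close>-th root of this bound is \<open>u R powr (1 / t) / R\<close>, which tends to
  \<open>1 / R\<close>, and \<open>R\<close> is arbitrary (\<open>legendre_root_tendsto_0\<close>).

  For monotonicity, \<open>t \<mapsto> u r / r powr t\<close> is decreasing for each fixed \<open>r \<ge> 1\<close>, so only the
  radii \<open>r < 1\<close> could let the infimum grow. There \<open>u r / r powr t\<close> is at least \<open>u r\<close>, hence
  bounded away from zero by compactness of \<open>[0, 1]\<close>, whereas the bound with \<open>R = 2\<close> decays to
  zero. So for large \<open>t\<close> the radii below \<open>1\<close> do not influence the infimum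
  (\<open>legendre_eventually_decreasing\<close>).
\<close>

lemma legendre_le:
  assumes "\<And>r. 0 < r \<Longrightarrow> 0 < u r" and "0 < r"
  shows "legendre u t \<le> u r / r powr t"
  unfolding legendre_def
proof (rule cINF_lower)
  show "bdd_below ((\<lambda>r. u r / r powr t) ` {0<..})"
    using assms(1) by (intro bdd_belowI2[of _ 0]) (simp add: less_imp_le)
qed (use assms(2) in simp)

lemma le_legendre:
  assumes "\<And>r. 0 < r \<Longrightarrow> c \<le> u r / r powr t"
  shows "c \<le> legendre u t"
  unfolding legendre_def using assms by (intro cINF_greatest) auto

lemma legendre_nonneg:
  assumes "\<And>r. 0 < r \<Longrightarrow> 0 < u r"
  shows "0 \<le> legendre u t"
  using assms by (intro le_legendre) (simp add: less_imp_le)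

text \<open>
  The threshold is any value beyond which the bound \<open>u 2 / 2 powr s\<close> lies below the minimum of
  \<open>u\<close> on \<open>[0, 1]\<close>.
\<close>

lemma legendre_eventually_decreasing:
  assumes cont: "continuous_on {0..} u" and pos: "\<And>r. 0 \<le> r \<Longrightarrow> 0 < u r"
  shows "\<exists>t0\<ge>0. \<forall>t s. t0 \<le> t \<and> t \<le> s \<longrightarrow> legendre u s \<le> legendre u t"
proof -
  have "continuous_on {0..1} u"
    using cont by (rule continuous_on_subset) auto
  then obtain r0 where r0: "r0 \<in> {0..1}" and min: "\<And>r. r \<in> {0..1} \<Longrightarrow> u r0 \<le> u r"
    using continuous_attains_inf[of "{0..1}" u] by auto
  have "((\<lambda>s. u 2 / 2 powr s) \<longlongrightarrow> 0) at_top"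
    unfolding powr_def
    by (auto intro!: tendsto_divide_0[OF tendsto_const] filterlim_at_top_imp_at_infinity
        filterlim_compose[OF exp_at_top] filterlim_at_top_mult_tendsto_pos[OF tendsto_const] filterlim_ident)
  moreover have "0 < u r0"
    using pos r0 by simp
  ultimately have "eventually (\<lambda>s. u 2 / 2 powr s < u r0) at_top"
    by (rule order_tendstoD(2))
  then obtain N where N: "\<And>s. N \<le> s \<Longrightarrow> u 2 / 2 powr s < u r0"
    by (auto simp: eventually_at_top_linorder)
  have "legendre u s \<le> legendre u t" if "max 0 N \<le> t" "t \<le> s" for t s
  proof (rule le_legendre)
    fix r :: real
    assume r: "0 < r"
    show "legendre u s \<le> u r / r powr t"
    proof (cases "r \<le> 1")
      case True
      have "legendre u s \<le> u 2 / 2 powr s"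
        using pos by (intro legendre_le) auto
      also have "\<dots> \<le> u r0"
        using N[of s] that by simp
      also have "\<dots> \<le> u r"
        using min r True by simp
      also have "\<dots> \<le> u r / r powr t"
        using pos[of r] r True that powr_le1[of t r] by (simp add: pos_le_divide_eq)
      finally show ?thesis .
    next
      case False
      have "legendre u s \<le> u r / r powr s"
        using pos r by (intro legendre_le) auto
      also have "\<dots> \<le> u r / r powr t"
        using pos[of r] False that by (intro divide_left_mono powr_mono) auto
      finally show ?thesis .
    qed
  qed
  then show ?thesis
    by (intro exI[of _ "max 0 N"]) auto
qed

lemma legendre_root_tendsto_0:
  assumes pos: "\<And>r. 0 < r \<Longrightarrow> 0 < u r"
  shows "((\<lambda>t. legendre u t powr (1 / t)) \<longlongrightarrow> 0) at_top"
proof (rule order_tendstoI)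
  fix a :: real
  assume "a < 0"
  then show "eventually (\<lambda>t. a < legendre u t powr (1 / t)) at_top"
    by (intro always_eventually allI) (meson powr_ge_zero less_le_trans)
next
  fix e :: real
  assume e: "0 < e"
  \<comment> \<open>Any radius with \<open>1 / R < e\<close> works.\<close>
  define R where "R = 2 / e"
  have R: "0 < R" "1 / R < e"
    using e by (auto simp: R_def)
  have "((\<lambda>t::real. 1 / t) \<longlongrightarrow> 0) at_top"
    by (intro tendsto_divide_0[OF tendsto_const] filterlim_at_top_imp_at_infinity filterlim_ident)
  then have "((\<lambda>t. u R powr (1 / t) / R) \<longlongrightarrow> u R powr 0 / R) at_top"
    using pos[OF R(1)] R(1) by (intro tendsto_intros) auto
  then have "eventually (\<lambda>t. u R powr (1 / t) / R < e) at_top"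
    using pos[OF R(1)] R(2) by (intro order_tendstoD(2)) auto
  then show "eventually (\<lambda>t. legendre u t powr (1 / t) < e) at_top"
    using eventually_gt_at_top[of 0]
  proof eventually_elim
    case (elim t)
    have "legendre u t powr (1 / t) \<le> (u R / R powr t) powr (1 / t)"
      using elim(2) legendre_le[OF pos R(1)] legendre_nonneg[OF pos] by (intro powr_mono2) auto
    also have "\<dots> = u R powr (1 / t) / R"
      using elim(2) R(1) pos[OF R(1)] by (simp add: powr_divide powr_powr)
    also have "\<dots> < e"
      by (rule elim(1))
    finally show ?case .
  qed
qed

theorem theorem3p6:
  fixes u :: "real \<Rightarrow> real"
  assumes "u \<in> C_plus_log"
    and "log_exp_convex u"
  shows "(\<exists>t0\<ge>0. \<forall>t s. t0 \<le> t \<and> t \<le> s \<longrightarrow> legendre u s \<le> legendre u t) \<and>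
         ((\<lambda>t. legendre u t powr (1 / t)) \<longlongrightarrow> 0) at_top"
proof -
  have "continuous_on {0..} u" and "\<And>r. 0 \<le> r \<Longrightarrow> 0 < u r"
    using assms(1) by (auto simp: C_plus_log_def)
  then show ?thesis
    using legendre_eventually_decreasing legendre_root_tendsto_0 by auto
qed

end
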